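(* Let $m\ge 1$ and let $A_m$ be a real symmetric $m\times m$ matrix. Then: (i) there exists a stochastic $m\times m$ matrix $X_m$ with $A_m=\frac{X_m+X_m^{t}}{2}$ if and only if $A_m\in\mathbf{U}^m$; (ii) there exists a substochastic $m\times m$ matrix $X_m$ with $A_m=\frac{X_m+X_m^{t}}{2}$ if and only if $A_m\in\mathbf{U}_m$.
   Context: $I_m=\{1,\dots,m\}$. $\mathbf{U}_m$ is the set of real $m\times m$ matrices $A_m=(a_{ij})_{i,j=1}^m$ with $a_{ij}=a_{ji}\ge 0$ for all $i,j$ and $\sum_{i,j\in\alpha}a_{ij}\le|\alpha|$ for every $\alpha\subset I_m$ ($|\alpha|$ = number of elements of $\alpha$). $\mathbf{U}^m=\{A_m\in\mathbf{U}_m:\ \sum_{i,j=1}^m a_{ij}=m\}$. A matrix is stochastic if its entries are nonnegative and every row sum equals $1$; substochastic if its entries are nonnegative and every row sum is at most $1$. $X^t$ is the transpose. *)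

theory Defs
  imports "HOL-Analysis.Analysis"
begin

text \<open>The index set \<open>I\<^sub>m\<close> is the universe of the finite type \<open>'m\<close>, with \<open>m = CARD('m) \<ge> 1\<close>;
  in \<open>real ^ 'm ^ 'm\<close> the entry in row \<open>i\<close> and column \<open>j\<close> is \<open>A $ i $ j\<close>.\<close>

definition symmetric_matrix :: "real ^ 'm ^ 'm \<Rightarrow> bool" where
  "symmetric_matrix A \<longleftrightarrow> transpose A = A"

definition stochastic :: "real ^ 'm ^ 'm \<Rightarrow> bool" where
  "stochastic X \<longleftrightarrow> (\<forall>i j. 0 \<le> X $ i $ j) \<and> (\<forall>i. (\<Sum>j\<in>UNIV. X $ i $ j) = 1)"

definition substochastic :: "real ^ 'm ^ 'm \<Rightarrow> bool" where
  "substochastic X \<longleftrightarrow> (\<forall>i j. 0 \<le> X $ i $ j) \<and> (\<forall>i. (\<Sum>j\<in>UNIV. X $ i $ j) \<le> 1)"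

text \<open>\<open>U_sub\<close> is the set \<open>\<^bold>U\<^sub>m\<close> and \<open>U_sup\<close> is the set \<open>\<^bold>U\<^sup>m\<close>. The set \<open>\<alpha>\<close> may be all of \<open>I\<^sub>m\<close>.\<close>

definition U_sub :: "(real ^ 'm ^ 'm) set" where
  "U_sub = {A. (\<forall>i j. A $ i $ j = A $ j $ i \<and> 0 \<le> A $ i $ j) \<and>
               (\<forall>\<alpha> :: 'm set. (\<Sum>i\<in>\<alpha>. \<Sum>j\<in>\<alpha>. A $ i $ j) \<le> real (card \<alpha>))}"

definition U_sup :: "(real ^ 'm ^ 'm) set" where
  "U_sup = {A \<in> U_sub. (\<Sum>i\<in>UNIV. \<Sum>j\<in>UNIV. A $ i $ j) = real CARD('m)}"

end

theory Submission
  imports Defs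
begin

text \<open>Among the nonnegative matrices \<open>X\<close> with \<open>X + X\<^sup>t = 2 A\<close>, choose one that minimises the sum of
  the squared row sums. If row \<open>i\<close> has a larger sum than row \<open>j\<close>, then \<open>X\<^sub>i\<^sub>j = 0\<close>, since moving a
  little mass from \<open>X\<^sub>i\<^sub>j\<close> to \<open>X\<^sub>j\<^sub>i\<close> would otherwise decrease the objective. Suppose some row sum
  \<open>c\<close> exceeds \<open>1\<close>, and let \<open>\<alpha>\<close> be the set of rows with sum at least \<open>c\<close>. The entries of these rows
  vanish outside \<open>\<alpha> \<times> \<alpha>\<close>, so the sum of \<open>A\<close> over \<open>\<alpha> \<times> \<alpha>\<close> is at least \<open>c |\<alpha>| > |\<alpha>|\<close>,
  a contradiction.\<close>

definition row_sum :: "real ^ 'n ^ 'm \<Rightarrow> 'm \<Rightarrow> real" where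
  "row_sum X i = (\<Sum>j\<in>UNIV. X $ i $ j)"

text \<open>The row sums are left free, so for \<open>A\<close> in \<open>U_sub\<close> the set
  contains \<open>A\<close> itself; the bound on the row sums comes from minimisation.\<close>

definition halves :: "real ^ 'm ^ 'm \<Rightarrow> (real ^ 'm ^ 'm) set" where
  "halves A = {X. \<forall>i j. 0 \<le> X $ i $ j \<and> X $ i $ j + X $ j $ i = 2 * A $ i $ j}"

lemma eq_half_add_transpose_iff:
  fixes A X :: "real ^ 'm ^ 'm"
  shows "A = (1 / 2) *\<^sub>R (X + transpose X) \<longleftrightarrow> (\<forall>i j. X $ i $ j + X $ j $ i = 2 * A $ i $ j)"
  by (auto simp: vec_eq_iff transpose_def field_simps)

text \<open>Two nonnegative entries adding up to \<open>2 * A $ i $ j\<close> are both bounded by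
  it. Compactness provides the minimiser.\<close>

lemma compact_halves: "compact (halves A)"
proof (rule compact_eq_bounded_closed[THEN iffD2], intro conjI)
  show "closed (halves A)"
    unfolding halves_def
    by (intro closed_Collect_all closed_Collect_conj closed_Collect_le closed_Collect_eq
        continuous_intros)
  have "norm X \<le> (\<Sum>i\<in>UNIV. \<Sum>j\<in>UNIV. 2 * A $ i $ j)" if X: "X \<in> halves A" for X
  proof -
    have le: "\<bar>X $ i $ j\<bar> \<le> 2 * A $ i $ j" for i j
    proof -
      have "0 \<le> X $ i $ j" "0 \<le> X $ j $ i" "X $ i $ j + X $ j $ i = 2 * A $ i $ j"
        using X by (auto simp: halves_def)
      then show ?thesis by linarith
    qed
    have "norm X \<le> (\<Sum>i\<in>UNIV. norm (X $ i))"
      unfolding norm_vec_def[of X] by (rule L2_set_le_sum) simp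
    also have "\<dots> \<le> (\<Sum>i\<in>UNIV. \<Sum>j\<in>UNIV. \<bar>X $ i $ j\<bar>)"
      by (intro sum_mono norm_le_l1_cart)
    also have "\<dots> \<le> (\<Sum>i\<in>UNIV. \<Sum>j\<in>UNIV. 2 * A $ i $ j)"
      by (intro sum_mono le)
    finally show ?thesis .
  qed
  then show "bounded (halves A)"
    by (rule boundedI)
qed

text \<open>The square \<alpha> x \<alpha> is invariant under transposition, so \<open>X\<close> and
  its transpose have the same sum over it.\<close>

lemma sum_square_halves:
  assumes "X \<in> halves A"
  shows "(\<Sum>i\<in>\<alpha>. \<Sum>j\<in>\<alpha>. X $ i $ j) = (\<Sum>i\<in>\<alpha>. \<Sum>j\<in>\<alpha>. A $ i $ j)"
proof -
  have "2 * (\<Sum>i\<in>\<alpha>. \<Sum>j\<in>\<alpha>. X $ i $ j)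
      = (\<Sum>i\<in>\<alpha>. \<Sum>j\<in>\<alpha>. X $ i $ j) + (\<Sum>i\<in>\<alpha>. \<Sum>j\<in>\<alpha>. X $ j $ i)"
    using sum.swap[of "\<lambda>i j. X $ i $ j" \<alpha> \<alpha>] by simp
  also have "\<dots> = (\<Sum>i\<in>\<alpha>. \<Sum>j\<in>\<alpha>. 2 * A $ i $ j)"
    using assms by (simp add: halves_def flip: sum.distrib)
  finally show ?thesis
    by (simp flip: sum_distrib_left)
qed

lemma sum_square_le_sum_row_sum:
  assumes "\<And>i j. 0 \<le> X $ i $ j"
  shows "(\<Sum>i\<in>\<alpha>. \<Sum>j\<in>\<alpha>. X $ i $ j) \<le> (\<Sum>i\<in>\<alpha>. row_sum X i)"
  unfolding row_sum_def by (intro sum_mono sum_mono2) (auto simp: assms)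

lemma minimal_halves_entry_eq_0:
  fixes A X :: "real ^ 'm ^ 'm"
  assumes X: "X \<in> halves A"
    and min: "\<And>Y. Y \<in> halves A \<Longrightarrow> (\<Sum>k\<in>UNIV. (row_sum X k)\<^sup>2) \<le> (\<Sum>k\<in>UNIV. (row_sum Y k)\<^sup>2)"
    and less: "row_sum X j < row_sum X i"
  shows "X $ i $ j = 0"
proof (rule ccontr)
  assume "X $ i $ j \<noteq> 0"
  then have pos: "0 < X $ i $ j"
    using X by (auto simp: halves_def less_le)
  have [simp]: "i \<noteq> j" "j \<noteq> i"
    using less by auto
  define d where "d = row_sum X i - row_sum X j"
  \<comment> \<open>The first bound keeps the reduced entry nonnegative. The second gives
    \<open>t < d\<close>, which makes the change \<open>2 * t * (t - d)\<close> of the objective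
    negative.\<close>
  define t where "t = min (X $ i $ j) (d / 2)"
  have t: "0 < t" "t \<le> X $ i $ j" "t < d"
    using pos less by (auto simp: t_def d_def min_def)
  \<comment> \<open>The resulting change of the row sums; it vanishes outside rows \<open>i\<close>
    and \<open>j\<close>, so only these two contribute to the difference of the objectives.\<close>
  define s where "s k = (if k = i then - t else if k = j then t else 0)" for k
  define Y :: "real ^ 'm ^ 'm" where
    "Y = (\<chi> k l. X $ k $ l + (if k = i then if l = j then - t else 0
      else if k = j then if l = i then t else 0 else 0))"
  have "Y \<in> halves A"
    using X t by (auto simp: halves_def Y_def)
  have row: "row_sum Y k = row_sum X k + s k" for k
  proof -
    have "(\<Sum>l\<in>UNIV. if k = i then if l = j then - t else 0
        else if k = j then if l = i then t else 0 else 0) = s k"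
      using \<open>i \<noteq> j\<close> by (cases "k = i"; cases "k = j"; simp add: s_def)
    then show ?thesis
      by (simp add: row_sum_def Y_def sum.distrib)
  qed
  have "(\<Sum>k\<in>UNIV. (row_sum Y k)\<^sup>2) - (\<Sum>k\<in>UNIV. (row_sum X k)\<^sup>2)
      = (\<Sum>k\<in>UNIV. 2 * row_sum X k * s k + (s k)\<^sup>2)"
    by (simp add: row power2_sum ac_simps flip: sum_subtractf)
  also have "\<dots> = (\<Sum>k\<in>{i, j}. 2 * row_sum X k * s k + (s k)\<^sup>2)"
    by (rule sum.mono_neutral_right) (auto simp: s_def)
  also have "\<dots> = 2 * t * (t - d)"
    by (simp add: s_def d_def power2_eq_square algebra_simps)
  also have "\<dots> < 0"
    using t by (simp add: mult_pos_neg)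
  finally show False
    using min[OF \<open>Y \<in> halves A\<close>] by simp
qed

lemma U_sub_obtain_halves:
  assumes "A \<in> U_sub"
  obtains X where "X \<in> halves A" "\<And>i. row_sum X i \<le> 1"
proof -
  have "A \<in> halves A"
    using assms by (auto simp: U_sub_def halves_def)
  moreover have "continuous_on (halves A) (\<lambda>X. \<Sum>k\<in>UNIV. (row_sum X k)\<^sup>2)"
    unfolding row_sum_def by (intro continuous_intros)
  ultimately have "\<exists>X\<in>halves A. \<forall>Y\<in>halves A.
      (\<Sum>k\<in>UNIV. (row_sum X k)\<^sup>2) \<le> (\<Sum>k\<in>UNIV. (row_sum Y k)\<^sup>2)"
    by (intro continuous_attains_inf compact_halves) auto
  then obtain X where X: "X \<in> halves A"
    and min: "\<And>Y. Y \<in> halves A \<Longrightarrow> (\<Sum>k\<in>UNIV. (row_sum X k)\<^sup>2) \<le> (\<Sum>k\<in>UNIV. (row_sum Y k)\<^sup>2)"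
    by blast
  have "row_sum X i \<le> 1" for i
  proof (rule ccontr)
    assume "\<not> row_sum X i \<le> 1"
    define \<alpha> where "\<alpha> = {k. row_sum X i \<le> row_sum X k}"
    have "real (card \<alpha>) < (\<Sum>k\<in>\<alpha>. row_sum X k)"
    proof -
      have "i \<in> \<alpha>"
        by (simp add: \<alpha>_def)
      \<comment> \<open>Every row in \<alpha> has sum at least \<open>row_sum X i\<close>, hence
        above 1; strictness of the total needs \<alpha> to be nonempty, and \<open>i\<close> lies in
        it.\<close>
      then have "(\<Sum>k\<in>\<alpha>. 1) < (\<Sum>k\<in>\<alpha>. row_sum X k)"
        using \<open>\<not> row_sum X i \<le> 1\<close> by (intro sum_strict_mono) (auto simp: \<alpha>_def)
      then show ?thesis by simp
    qed
    also have "\<dots> = (\<Sum>k\<in>\<alpha>. \<Sum>l\<in>\<alpha>. X $ k $ l)"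
    proof (rule sum.cong[OF refl])
      fix k
      assume "k \<in> \<alpha>"
      \<comment> \<open>A row outside this upper level set has a sum strictly below that of row
        \<open>i\<close>, hence below that of row \<open>k\<close>, so minimality applies.\<close>
      have "X $ k $ l = 0" if "l \<notin> \<alpha>" for l
        using \<open>k \<in> \<alpha>\<close> that by (intro minimal_halves_entry_eq_0[OF X min]) (auto simp: \<alpha>_def)
      then show "row_sum X k = (\<Sum>l\<in>\<alpha>. X $ k $ l)"
        unfolding row_sum_def by (intro sum.mono_neutral_right) auto
    qed
    also have "\<dots> = (\<Sum>k\<in>\<alpha>. \<Sum>l\<in>\<alpha>. A $ k $ l)"
      by (rule sum_square_halves[OF X])
    also have "\<dots> \<le> real (card \<alpha>)"
      using assms by (simp add: U_sub_def)
    finally show False by simp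
  qed
  with X that show ?thesis by blast
qed

text \<open>Over \<alpha> x \<alpha> the matrices \<open>A\<close> and \<open>X\<close> have equal
  sums, and completing the rows of \<open>X\<close> in \<alpha> only adds nonnegative
  entries.\<close>

lemma halves_imp_U_sub:
  assumes X: "X \<in> halves A" and le: "\<And>i. row_sum X i \<le> 1"
  shows "A \<in> U_sub"
proof -
  have nonneg: "0 \<le> X $ i $ j" and eq: "X $ i $ j + X $ j $ i = 2 * A $ i $ j" for i j
    using X by (auto simp: halves_def)
  have "A $ i $ j = A $ j $ i \<and> 0 \<le> A $ i $ j" for i j
    using nonneg[of i j] nonneg[of j i] eq[of i j] eq[of j i] by linarith
  moreover have "(\<Sum>i\<in>\<alpha>. \<Sum>j\<in>\<alpha>. A $ i $ j) \<le> real (card \<alpha>)" for \<alpha>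
  proof -
    have "(\<Sum>i\<in>\<alpha>. \<Sum>j\<in>\<alpha>. A $ i $ j) \<le> (\<Sum>i\<in>\<alpha>. row_sum X i)"
      using sum_square_le_sum_row_sum[of X \<alpha>, OF nonneg] by (simp add: sum_square_halves[OF X])
    also have "\<dots> \<le> real (card \<alpha>)"
      using sum_bounded_above[of \<alpha> "row_sum X" 1] le by simp
    finally show ?thesis .
  qed
  ultimately show ?thesis
    by (simp add: U_sub_def)
qed

lemma substochastic_half_iff_halves:
  "substochastic X \<and> A = (1 / 2) *\<^sub>R (X + transpose X) \<longleftrightarrow>
    X \<in> halves A \<and> (\<forall>i. row_sum X i \<le> 1)"
  unfolding eq_half_add_transpose_iff by (auto simp: substochastic_def halves_def row_sum_def)

lemma stochastic_half_iff_halves: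
  "stochastic X \<and> A = (1 / 2) *\<^sub>R (X + transpose X) \<longleftrightarrow>
    X \<in> halves A \<and> (\<forall>i. row_sum X i = 1)"
  unfolding eq_half_add_transpose_iff by (auto simp: stochastic_def halves_def row_sum_def)

text \<open>The deficits \<open>1 - row_sum X i\<close> are nonnegative, so all vanish exactly when
  their total does, and that total depends only on \<open>A\<close>.\<close>

lemma row_sum_eq_1_iff:
  fixes A X :: "real ^ 'm ^ 'm"
  assumes X: "X \<in> halves A" and le: "\<And>i. row_sum X i \<le> 1"
  shows "(\<forall>i. row_sum X i = 1) \<longleftrightarrow> (\<Sum>i\<in>UNIV. \<Sum>j\<in>UNIV. A $ i $ j) = real CARD('m)"
proof -
  have "(\<Sum>i\<in>UNIV. 1 - row_sum X i) = real CARD('m) - (\<Sum>i\<in>UNIV. \<Sum>j\<in>UNIV. A $ i $ j)"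
    using sum_square_halves[OF X, of UNIV] by (simp add: sum_subtractf row_sum_def)
  moreover have "(\<Sum>i\<in>UNIV. 1 - row_sum X i) = 0 \<longleftrightarrow> (\<forall>i\<in>UNIV. 1 - row_sum X i = 0)"
    by (rule sum_nonneg_eq_0_iff) (auto simp: le)
  ultimately show ?thesis
    by auto
qed

theorem theorem1p3:
  fixes A :: "real ^ 'm ^ 'm"
  assumes "symmetric_matrix A"
  shows "((\<exists>X :: real ^ 'm ^ 'm. stochastic X \<and> A = (1 / 2) *\<^sub>R (X + transpose X)) \<longleftrightarrow> A \<in> U_sup) \<and>
         ((\<exists>X :: real ^ 'm ^ 'm. substochastic X \<and> A = (1 / 2) *\<^sub>R (X + transpose X)) \<longleftrightarrow> A \<in> U_sub)"
  unfolding stochastic_half_iff_halves substochastic_half_iff_halves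
proof (intro conjI iffI)
  assume "\<exists>X. X \<in> halves A \<and> (\<forall>i. row_sum X i = 1)"
  then obtain X where X: "X \<in> halves A" and eq: "\<forall>i. row_sum X i = 1"
    by blast
  from eq have le: "\<And>i. row_sum X i \<le> 1"
    by simp
  show "A \<in> U_sup"
    using halves_imp_U_sub[OF X le] row_sum_eq_1_iff[OF X le] eq by (simp add: U_sup_def)
next
  assume A: "A \<in> U_sup"
  then have "A \<in> U_sub"
    by (simp add: U_sup_def)
  then obtain X where X: "X \<in> halves A" and le: "\<And>i. row_sum X i \<le> 1"
    using U_sub_obtain_halves by blast
  \<comment> \<open>The substochastic solution is already stochastic, because the entries of
    \<open>A\<close> have total m.\<close>
  have "\<forall>i. row_sum X i = 1"
    using A row_sum_eq_1_iff[OF X le] by (simp add: U_sup_def)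
  with X show "\<exists>X. X \<in> halves A \<and> (\<forall>i. row_sum X i = 1)"
    by blast
next
  assume "\<exists>X. X \<in> halves A \<and> (\<forall>i. row_sum X i \<le> 1)"
  then show "A \<in> U_sub"
    using halves_imp_U_sub by blast
next
  assume "A \<in> U_sub"
  then show "\<exists>X. X \<in> halves A \<and> (\<forall>i. row_sum X i \<le> 1)"
    using U_sub_obtain_halves by blast
qed

end
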